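(* Let $\lambda_1,\lambda,\beta>0$, let $N_1$ be a Poisson process with intensity $\lambda_1$, and let $E_N(t)=E(N(t))$, $t\ge0$, be the compound Poisson-exponential subordinator with parameters $\lambda,\beta$, independent of $N_1$. For an integer $k\ge1$ let $T_k^E=\inf\{s:N_1(E_N(s))=k\}$. Then for every $k\ge 1$ $$P\{T_k^E<\infty\}=\frac{\beta}{\lambda_1+\beta}.$$
   Context: The exponential process $E$ with parameter $\beta$ is the subordinator with $E e^{-uE(t)}=(1+u/\beta)^{-t}$ (the Gamma process with shape parameter $1$ and rate $\beta$). The compound Poisson-exponential subordinator with parameters $\lambda,\beta$ is $E_N(t)=E(N(t))$, where $N$ is a Poisson process with intensity $\lambda$ independent of $E$, i.e. a compound Poisson process with intensity $\lambda$ and exponentially distributed (rate $\beta$) jumps; its Laplace exponent is $f(u)=\lambda u/(\beta+u)$. The convention $\inf\emptyset=\infty$ is used. *)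

theory Defs
  imports "HOL-Probability.Probability"
begin

text \<open>
  A stochastic process is a curried function of time and outcome. Only times \<open>t \<ge> 0\<close> matter;
  values at negative times are unconstrained.
\<close>

definition independent_increments :: "'a measure \<Rightarrow> (real \<Rightarrow> 'a \<Rightarrow> real) \<Rightarrow> bool" where
  "independent_increments M X \<longleftrightarrow>
     (\<forall>(n::nat) (t::nat \<Rightarrow> real). 0 \<le> t 0 \<longrightarrow> (\<forall>i<n. t i \<le> t (Suc i)) \<longrightarrow>
        prob_space.indep_vars M (\<lambda>_. borel) (\<lambda>i \<omega>. X (t (Suc i)) \<omega> - X (t i) \<omega>) {..<n})"

definition stationary_increments :: "'a measure \<Rightarrow> (real \<Rightarrow> 'a \<Rightarrow> real) \<Rightarrow> bool" where
  "stationary_increments M X \<longleftrightarrow>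
     (\<forall>s\<ge>0. \<forall>h\<ge>0. distr M borel (\<lambda>\<omega>. X (s + h) \<omega> - X s \<omega>) = distr M borel (X h))"

text \<open>
  A subordinator is a Levy process with almost surely nondecreasing paths. Left limits come for
  free from monotonicity, and stochastic continuity from right-continuity at 0 together with
  stationarity of the increments. Path regularity is only almost sure, so path events such as
  \<open>hitting_time Z k < \<infinity>\<close> may differ from a measurable set by a subset of a null set; their
  probability is therefore taken in \<open>completion M\<close>, which agrees with \<open>M\<close> on \<open>sets M\<close>.
\<close>

definition subordinator :: "'a measure \<Rightarrow> (real \<Rightarrow> 'a \<Rightarrow> real) \<Rightarrow> bool" where
  "subordinator M X \<longleftrightarrow>
     (\<forall>t\<ge>0. X t \<in> borel_measurable M) \<and>
     (AE \<omega> in M. X 0 \<omega> = 0) \<and>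
     independent_increments M X \<and>
     stationary_increments M X \<and>
     (AE \<omega> in M. mono_on {0..} (\<lambda>t. X t \<omega>)) \<and>
     (AE \<omega> in M. \<forall>t\<ge>0. continuous (at_right t) (\<lambda>s. X s \<omega>))"

text \<open>
  \<open>poisson_pmf\<close> is meaningful for positive rates only; the law at time 0 is given by the
  condition \<open>X 0 = 0\<close> of \<open>subordinator\<close>.
\<close>

definition poisson_process :: "'a measure \<Rightarrow> real \<Rightarrow> (real \<Rightarrow> 'a \<Rightarrow> nat) \<Rightarrow> bool" where
  "poisson_process M l N \<longleftrightarrow>
     subordinator M (\<lambda>t \<omega>. real (N t \<omega>)) \<and>
     (\<forall>t>0. distr M (count_space UNIV) (N t) = measure_pmf (poisson_pmf (l * t)))"

definition exponential_process :: "'a measure \<Rightarrow> real \<Rightarrow> (real \<Rightarrow> 'a \<Rightarrow> real) \<Rightarrow> bool" where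
  "exponential_process M b E \<longleftrightarrow>
     subordinator M E \<and>
     (\<forall>t\<ge>0. \<forall>u\<ge>0. (\<integral>\<omega>. exp (- u * E t \<omega>) \<partial>M) = (1 + u / b) powr (- t))"

text \<open>
  Independence of two processes as random elements of the path space with its product
  sigma-algebra, i.e. independence of the sigma-algebras they generate.
\<close>

definition indep_processes ::
  "'a measure \<Rightarrow> (real \<Rightarrow> 'a \<Rightarrow> real) \<Rightarrow> (real \<Rightarrow> 'a \<Rightarrow> real) \<Rightarrow> bool" where
  "indep_processes M X Y \<longleftrightarrow>
     prob_space.indep_var M
       (\<Pi>\<^sub>M t\<in>{0..}. borel) (\<lambda>\<omega>. \<lambda>t\<in>{0..}. X t \<omega>)
       (\<Pi>\<^sub>M t\<in>{0..}. borel) (\<lambda>\<omega>. \<lambda>t\<in>{0..}. Y t \<omega>)"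

definition time_changed ::
  "(real \<Rightarrow> 'a \<Rightarrow> 'b) \<Rightarrow> (real \<Rightarrow> 'a \<Rightarrow> real) \<Rightarrow> real \<Rightarrow> 'a \<Rightarrow> 'b" where
  "time_changed X Y t \<omega> = X (Y t \<omega>) \<omega>"

text \<open>Valued in \<open>ereal\<close>, where the infimum of the empty set is \<open>\<infinity>\<close>.\<close>

definition hitting_time :: "(real \<Rightarrow> 'a \<Rightarrow> 'b) \<Rightarrow> 'b \<Rightarrow> 'a \<Rightarrow> ereal" where
  "hitting_time Z k \<omega> = Inf {ereal s | s. s \<ge> 0 \<and> Z s \<omega> = k}"

end

theory Submission
  imports Defs
begin

text \<open>
  Almost surely \<open>N\<close> takes every natural value, so the level \<open>k\<close> is hit iff \<open>N\<^sub>1 (S n) = k\<close> for some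
  \<open>n\<close>, where \<open>S n = E n\<close> is a random walk with exponential steps. By independence, \<open>N\<^sub>1\<close> and \<open>S\<close>
  may be sampled on the two factors of \<open>M \<Otimes> M\<close>. Conditioning on \<open>S\<close> and splitting according to the
  last such \<open>n\<close>, the probability is the sum over \<open>n\<close> of the expectations of
  \<open>p k (S n) * (1 - exp (- l\<^sub>1 (S (n + 1) - S n)))\<close>, where \<open>p k x\<close> is the probability that \<open>N\<^sub>1 x = k\<close>.
  The second factor is independent of the first and has mean \<open>l\<^sub>1 / (l\<^sub>1 + \<beta>)\<close>. The first factors
  add up to \<open>\<beta> / l\<^sub>1\<close>, which is read off the generating function in \<open>k\<close>, so that only the Laplace
  transform of \<open>E\<close> is needed and not its law.
\<close>

section \<open>Poisson probabilities, generating functions and series\<close>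

text \<open>An explicit formula in place of the probability mass function, so that mean 0 is covered
  as well and Borel measurability in the mean is immediate.\<close>

definition poisson_weight :: "real \<Rightarrow> nat \<Rightarrow> real" where
  "poisson_weight x k = exp (- x) * x ^ k / fact k"

lemma poisson_weight_nonneg: "x \<ge> 0 \<Longrightarrow> poisson_weight x k \<ge> 0"
  by (simp add: poisson_weight_def)

lemma poisson_weight_zero [simp]: "poisson_weight 0 k = (if k = 0 then 1 else 0)"
  by (simp add: poisson_weight_def)

lemma borel_measurable_poisson_weight [measurable]:
  "(\<lambda>x. poisson_weight x k) \<in> borel_measurable borel"
  unfolding poisson_weight_def by measurable

text \<open>Pulling out \<open>exp (- x)\<close> leaves the exponential series at
  \<open>z * x\<close>. The exponent is written so that, with \<open>x\<close> replaced by
  \<open>l * E t\<close>, the right side is a Laplace transform integrand with argument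
  \<open>(1 - z) * l\<close>.\<close>

lemma poisson_weight_gf_sums: "(\<lambda>k. poisson_weight x k * z ^ k) sums exp (- ((1 - z) * x))"
proof -
  have "(\<lambda>k. exp (- x) * ((z * x) ^ k /\<^sub>R fact k)) sums (exp (- x) * exp (z * x))"
    by (intro sums_mult exp_converges)
  moreover have "exp (- x) * exp (z * x) = exp (- ((1 - z) * x))"
    by (simp add: exp_add [symmetric] algebra_simps)
  moreover have "exp (- x) * ((z * x) ^ k /\<^sub>R fact k) = poisson_weight x k * z ^ k" for k
    by (simp add: poisson_weight_def power_mult_distrib divide_inverse)
  ultimately show ?thesis by simp
qed

text \<open>Exponential decay beats the power. This is why a Poisson process cannot stay below a
  fixed level.\<close>

lemma poisson_weight_tendsto_zero:
  assumes "filterlim f at_top F"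
  shows "((\<lambda>x. poisson_weight (f x) k) \<longlongrightarrow> 0) F"
proof -
  have "((\<lambda>x::real. x ^ k / exp x) \<longlongrightarrow> 0) at_top"
    by (rule tendsto_power_div_exp_0)
  then have "((\<lambda>x. f x ^ k / exp (f x) / fact k) \<longlongrightarrow> 0 / fact k) F"
    by (intro tendsto_divide filterlim_compose [OF _ assms]) auto
  then show ?thesis
    by (simp add: poisson_weight_def exp_minus divide_inverse mult_ac)
qed

text \<open>Subtracting \<open>c\<close> from every coefficient reduces this to a power series
  \<open>b\<close> with sum 0 on (0, 1). If the coefficients below \<open>k\<close> vanish, division
  by \<open>z ^ k\<close> leaves a power series \<open>g\<close> that is still 0 on (0, 1);
  continuity at 0 gives \<open>b k = g 0 = 0\<close>.\<close>

lemma geometric_coefficients_unique: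
  fixes a :: "nat \<Rightarrow> real" and c :: real
  assumes "\<And>z. 0 < z \<Longrightarrow> z < 1 \<Longrightarrow> (\<lambda>k. a k * z ^ k) sums (c / (1 - z))"
  shows "a k = c"
proof -
  define b where "b k = a k - c" for k
  have sums: "(\<lambda>k. b k * z ^ k) sums 0" if "0 < z" "z < 1" for z
  proof -
    have "(\<lambda>k. c * z ^ k) sums (c * (1 / (1 - z)))"
      using that by (intro sums_mult geometric_sums) auto
    from sums_diff [OF assms [OF that] this] show ?thesis
      by (simp add: b_def algebra_simps)
  qed
  have "b k = 0"
  proof (induction k rule: less_induct)
    case (less k)
    define g where "g z = (\<Sum>n. b (n + k) * z ^ n)" for z
    have zero: "g z = 0" and summ: "summable (\<lambda>n. b (n + k) * z ^ n)" if z: "0 < z" "z < 1" for z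
    proof -
      have "(\<lambda>n. b (n + k) * z ^ (n + k)) sums (0 - (\<Sum>i<k. b i * z ^ i))"
        using sums [OF z] by (subst sums_iff_shift) simp
      then have "(\<lambda>n. z ^ k * (b (n + k) * z ^ n)) sums 0"
        using less by (simp add: power_add mult_ac)
      then have "(\<lambda>n. b (n + k) * z ^ n) sums 0"
        using sums_mult_D [of "z ^ k" _ 0] z by auto
      then show "g z = 0" "summable (\<lambda>n. b (n + k) * z ^ n)"
        by (auto simp: g_def sums_iff)
    qed
    \<comment> \<open>Summability at the single point 1/2 gives continuity inside the disc of that
      radius.\<close>
    have "isCont g 0"
      unfolding g_def by (rule isCont_powser [of _ "1 / 2"]) (auto intro: summ)
    then have "(g \<longlongrightarrow> g 0) (at_right 0)"
      by (auto simp: isCont_def intro: tendsto_within_subset)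
    moreover have "\<forall>\<^sub>F z in at_right 0. g z = 0"
      using zero by (auto simp: eventually_at_right_field intro!: exI [of _ 1])
    ultimately have "g 0 = 0"
      by (metis tendsto_unique trivial_limit_at_right_real tendsto_eventually)
    moreover have "g 0 = b k"
      unfolding g_def using powser_zero [of "\<lambda>n. b (n + k)"] by simp
    ultimately show ?case by simp
  qed
  then show ?thesis by (simp add: b_def)
qed

text \<open>Tonelli: one of the two sums is read as an integral against counting measure.\<close>

lemma suminf_swap_ennreal:
  fixes f :: "nat \<Rightarrow> nat \<Rightarrow> ennreal"
  shows "(\<Sum>k. \<Sum>n. f k n) = (\<Sum>n. \<Sum>k. f k n)"
  using nn_integral_suminf [of "\<lambda>n k. f k n" "count_space UNIV"]
  by (simp add: nn_integral_count_space_nat)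

text \<open>A geometric series of ratio \<open>1 / (1 + q)\<close> without its term of index 0. With
  \<open>q = u / \<beta>\<close> the terms are the Laplace transforms of \<open>E 1\<close>,
  \<open>E 2\<close>, ... at \<open>u\<close>, hence the \<open>powr\<close> form.\<close>

lemma sums_geometric_inverse:
  fixes q :: real
  assumes "q > 0"
  shows "(\<lambda>n. (1 + q) powr (- real (Suc n))) sums (1 / q)"
proof -
  have "(\<lambda>n. (1 / (1 + q)) ^ n) sums (1 / (1 - 1 / (1 + q)))"
    using assms by (intro geometric_sums) auto
  then have "(\<lambda>n. 1 / (1 + q) * (1 / (1 + q)) ^ n) sums (1 / (1 + q) * (1 / (1 - 1 / (1 + q))))"
    by (rule sums_mult)
  moreover have "1 / (1 + q) * (1 / (1 - 1 / (1 + q))) = 1 / q"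
    using assms by (simp add: field_simps)
  moreover have "1 / (1 + q) * (1 / (1 + q)) ^ n = (1 + q) powr (- real (Suc n))" for n
  proof -
    have "0 < 1 + q" using assms by simp
    from powr_realpow [OF this, of "Suc n"]
    have "(1 + q) powr (- real (Suc n)) = 1 / (1 + q) ^ Suc n"
      by (simp only: powr_minus divide_inverse mult_1)
    then show ?thesis by (simp add: power_one_over)
  qed
  ultimately show ?thesis by simp
qed

section \<open>Reading a right-continuous path from its values on grids\<close>

text \<open>The least multiple of \<open>1 / real (Suc m)\<close> strictly above \<open>x\<close>.
  Strictness matters when \<open>x\<close> is itself a grid point: the approximation has to stay
  inside \<open>at_right x\<close>.\<close>

definition upper_grid :: "nat \<Rightarrow> real \<Rightarrow> real" where
  "upper_grid m x = real_of_int (\<lfloor>real (Suc m) * x\<rfloor> + 1) / real (Suc m)"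

lemma upper_grid_greater: "x < upper_grid m x"
proof -
  have "real (Suc m) * x < real_of_int (\<lfloor>real (Suc m) * x\<rfloor> + 1)"
    using floor_correct [of "real (Suc m) * x"] by blast
  then show ?thesis
    unfolding upper_grid_def
    by (subst pos_less_divide_eq) (simp_all add: mult.commute del: of_nat_Suc)
qed

lemma upper_grid_le: "upper_grid m x \<le> x + 1 / real (Suc m)"
proof -
  have "real_of_int (\<lfloor>real (Suc m) * x\<rfloor> + 1) \<le> real (Suc m) * x + 1"
    by (simp del: of_nat_Suc)
  then have "upper_grid m x \<le> (real (Suc m) * x + 1) / real (Suc m)"
    unfolding upper_grid_def by (rule divide_right_mono) simp
  also have "\<dots> = x + 1 / real (Suc m)"
    by (simp add: add_divide_distrib del: of_nat_Suc)
  finally show ?thesis .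
qed

lemma filterlim_upper_grid: "filterlim (\<lambda>m. upper_grid m x) (at_right x) sequentially"
proof -
  have "(\<lambda>m. x + 1 / real (Suc m)) \<longlonglongrightarrow> x + 0"
    by (intro tendsto_add tendsto_const LIMSEQ_Suc [OF lim_1_over_n])
  then have "(\<lambda>m. x + 1 / real (Suc m)) \<longlonglongrightarrow> x" by simp
  then have "(\<lambda>m. upper_grid m x) \<longlonglongrightarrow> x"
    by (rule tendsto_sandwich [rotated 3])
       (auto intro!: always_eventually less_imp_le [OF upper_grid_greater] upper_grid_le
         simp del: of_nat_Suc)
  then show ?thesis
    unfolding filterlim_at using upper_grid_greater [of x]
    by (auto intro!: always_eventually simp: less_imp_neq [symmetric] dest: less_imp_neq)
qed

text \<open>Expresses \<open>f y = k\<close>, for \<open>f\<close> right-continuous, through the values of \<open>f\<close> at countably many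
  fixed times. Unlike \<open>f y = k\<close> itself, this is measurable in \<open>(f, y)\<close> on the path space.\<close>

definition grid_value :: "(real \<Rightarrow> real) \<Rightarrow> real \<Rightarrow> nat \<Rightarrow> bool" where
  "grid_value f y k \<longleftrightarrow> (\<exists>m0. \<forall>m\<ge>m0. \<exists>j::nat.
     \<lfloor>real (Suc m) * y\<rfloor> = int j \<and> f (real (Suc j) / real (Suc m)) = real k)"

text \<open>Right-continuity makes the values at \<open>upper_grid m y\<close> converge to the value
  at \<open>y\<close>. Distinct naturals are at distance at least 1, so the convergence is eventual
  equality.\<close>

lemma grid_value_iff:
  fixes f :: "real \<Rightarrow> nat"
  assumes "y \<ge> 0" and "continuous (at_right y) (\<lambda>s. real (f s))"
  shows "grid_value (\<lambda>s. real (f s)) y k \<longleftrightarrow> f y = k"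
proof -
  have "((\<lambda>s. real (f s)) \<longlongrightarrow> real (f y)) (at_right y)"
    using assms(2) by (simp add: continuous_within)
  then have "(\<lambda>m. real (f (upper_grid m y))) \<longlonglongrightarrow> real (f y)"
    by (rule filterlim_compose [OF _ filterlim_upper_grid])
  then have "\<forall>\<^sub>F m in sequentially. dist (real (f (upper_grid m y))) (real (f y)) < 1"
    by (rule tendstoD) simp
  then have ev: "\<forall>\<^sub>F m in sequentially. f (upper_grid m y) = f y"
    by eventually_elim (auto simp: dist_real_def)
  have "(\<exists>j::nat. \<lfloor>real (Suc m) * y\<rfloor> = int j \<and> real (f (real (Suc j) / real (Suc m))) = real k)
          \<longleftrightarrow> f (upper_grid m y) = k" for m
  proof -
    \<comment> \<open>Since \<open>y\<close> is nonnegative the floor is a natural \<open>j\<close>,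
      and the grid point is the fixed time \<open>real (Suc j) / real (Suc m)\<close>.\<close>
    have "\<lfloor>real (Suc m) * y\<rfloor> \<ge> 0" using assms(1) by simp
    then obtain j where j: "\<lfloor>real (Suc m) * y\<rfloor> = int j" using nonneg_int_cases by blast
    then have "upper_grid m y = real (Suc j) / real (Suc m)"
      by (simp add: upper_grid_def add.commute)
    with j show ?thesis by auto
  qed
  then have "grid_value (\<lambda>s. real (f s)) y k \<longleftrightarrow>
      (\<forall>\<^sub>F m in sequentially. f (upper_grid m y) = k)"
    by (simp add: grid_value_def eventually_sequentially)
  also have "\<dots> \<longleftrightarrow> (\<forall>\<^sub>F m in sequentially. f y = k)"
    by (rule eventually_subst, rule eventually_mono [OF ev]) simp
  finally show ?thesis by (simp add: eventually_const)
qed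

text \<open>Only countably many fixed times enter, all of them nonnegative, so measurability of each
  single coordinate is enough.\<close>

lemma measurable_grid_value:
  assumes f: "\<And>t. t \<ge> 0 \<Longrightarrow> (\<lambda>x. f x t) \<in> borel_measurable L"
    and [measurable]: "g \<in> borel_measurable L"
  shows "Measurable.pred L (\<lambda>x. grid_value (f x) (g x) k)"
proof -
  have [measurable]: "Measurable.pred L (\<lambda>x. f x (real (Suc j) / real (Suc m)) = real k)"
    for j m
  proof -
    have [measurable]: "(\<lambda>x. f x (real (Suc j) / real (Suc m))) \<in> borel_measurable L"
      by (rule f) simp
    show ?thesis by measurable
  qed
  have [measurable]: "Measurable.pred L (\<lambda>x. \<lfloor>real (Suc m) * g x\<rfloor> = int j)" for m j
    by measurable
  show ?thesis unfolding grid_value_def by measurable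
qed

section \<open>Increments of a subordinator\<close>

context prob_space
begin

text \<open>Independence is applied to the two increments over 0, \<open>s\<close>,
  \<open>t\<close>. Since \<open>X 0 = 0\<close> almost surely, the first increment may be replaced
  by \<open>X s\<close>; stationarity turns the second into \<open>X (t - s)\<close>.\<close>

lemma indep_increments_nn_integral:
  assumes X: "subordinator M X" and st: "0 \<le> s" "s \<le> t"
    and [measurable]: "f \<in> borel_measurable borel" "g \<in> borel_measurable borel"
  shows "(\<integral>\<^sup>+\<omega>. f (X s \<omega>) * g (X t \<omega> - X s \<omega>) \<partial>M)
       = (\<integral>\<^sup>+\<omega>. f (X s \<omega>) \<partial>M) * (\<integral>\<^sup>+\<omega>. g (X (t - s) \<omega>) \<partial>M)"
proof -
  have [measurable]: "X s \<in> borel_measurable M" "X t \<in> borel_measurable M"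
      "X 0 \<in> borel_measurable M" "X (t - s) \<in> borel_measurable M"
    using X st by (auto simp: subordinator_def)
  have X0: "AE \<omega> in M. X 0 \<omega> = 0" using X by (simp add: subordinator_def)
  define T where "T i = (if i = 0 then 0 else if i = Suc 0 then s else t)" for i :: nat
  define F where "F i = (if i = 0 then f else g)" for i :: nat
  have "indep_vars (\<lambda>_. borel) (\<lambda>i \<omega>. X (T (Suc i)) \<omega> - X (T i) \<omega>) {..<2}"
    using X st unfolding subordinator_def independent_increments_def
    by (auto simp: T_def dest!: spec [of _ "2::nat"] spec [of _ T])
  then have "indep_vars (\<lambda>_. borel) (\<lambda>i \<omega>. F i (X (T (Suc i)) \<omega> - X (T i) \<omega>)) {..<2}"
    by (rule indep_vars_compose2) (simp add: F_def)
  from indep_vars_nn_integral [OF _ this]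
  have prod: "(\<integral>\<^sup>+\<omega>. f (X s \<omega> - X 0 \<omega>) * g (X t \<omega> - X s \<omega>) \<partial>M)
     = (\<integral>\<^sup>+\<omega>. f (X s \<omega> - X 0 \<omega>) \<partial>M) * (\<integral>\<^sup>+\<omega>. g (X t \<omega> - X s \<omega>) \<partial>M)"
    by (simp add: numeral_2_eq_2 lessThan_Suc F_def T_def mult.commute)
  have dist: "distr M borel (\<lambda>\<omega>. X t \<omega> - X s \<omega>) = distr M borel (X (t - s))"
  proof -
    have "stationary_increments M X" using X by (simp add: subordinator_def)
    then have "distr M borel (\<lambda>\<omega>. X (s + (t - s)) \<omega> - X s \<omega>) = distr M borel (X (t - s))"
      unfolding stationary_increments_def using st by (metis diff_ge_0_iff_ge)
    then show ?thesis by simp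
  qed
  have "(\<integral>\<^sup>+\<omega>. g (X t \<omega> - X s \<omega>) \<partial>M) = (\<integral>\<^sup>+x. g x \<partial>distr M borel (\<lambda>\<omega>. X t \<omega> - X s \<omega>))"
    by (simp add: nn_integral_distr)
  also have "\<dots> = (\<integral>\<^sup>+\<omega>. g (X (t - s) \<omega>) \<partial>M)"
    unfolding dist by (simp add: nn_integral_distr)
  finally have 1: "(\<integral>\<^sup>+\<omega>. g (X t \<omega> - X s \<omega>) \<partial>M) = (\<integral>\<^sup>+\<omega>. g (X (t - s) \<omega>) \<partial>M)" .
  have 2: "(\<integral>\<^sup>+\<omega>. f (X s \<omega> - X 0 \<omega>) \<partial>M) = (\<integral>\<^sup>+\<omega>. f (X s \<omega>) \<partial>M)"
    by (rule nn_integral_cong_AE) (use X0 in eventually_elim, simp)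
  have 3: "(\<integral>\<^sup>+\<omega>. f (X s \<omega> - X 0 \<omega>) * g (X t \<omega> - X s \<omega>) \<partial>M)
      = (\<integral>\<^sup>+\<omega>. f (X s \<omega>) * g (X t \<omega> - X s \<omega>) \<partial>M)"
    by (rule nn_integral_cong_AE) (use X0 in eventually_elim, simp)
  show ?thesis using prod unfolding 1 2 3 .
qed

lemma prob_indep_increments:
  assumes X: "subordinator M X" and st: "0 \<le> s" "s \<le> t"
    and [measurable]: "A \<in> sets borel" "B \<in> sets borel"
  shows "\<P>(\<omega> in M. X s \<omega> \<in> A \<and> X t \<omega> - X s \<omega> \<in> B)
       = \<P>(\<omega> in M. X s \<omega> \<in> A) * \<P>(\<omega> in M. X (t - s) \<omega> \<in> B)"
proof -
  have [measurable]: "X s \<in> borel_measurable M" "X t \<in> borel_measurable M"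
      "X (t - s) \<in> borel_measurable M"
    using X st by (auto simp: subordinator_def)
  have em: "(\<integral>\<^sup>+\<omega>. indicator C (Y \<omega>) \<partial>M) = emeasure M {\<omega>\<in>space M. Y \<omega> \<in> C}"
    if [measurable]: "C \<in> sets borel" "Y \<in> borel_measurable M" for C and Y :: "'a \<Rightarrow> real"
  proof -
    have "(\<integral>\<^sup>+\<omega>. indicator C (Y \<omega>) \<partial>M) = (\<integral>\<^sup>+\<omega>. indicator {\<omega>\<in>space M. Y \<omega> \<in> C} \<omega> \<partial>M)"
      by (rule nn_integral_cong) (simp split: split_indicator)
    also have "\<dots> = emeasure M {\<omega>\<in>space M. Y \<omega> \<in> C}"
      by (rule nn_integral_indicator) measurable
    finally show ?thesis .
  qed
  have "(\<integral>\<^sup>+\<omega>. indicator A (X s \<omega>) * indicator B (X t \<omega> - X s \<omega>) \<partial>M)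
     = (\<integral>\<^sup>+\<omega>. indicator {\<omega>\<in>space M. X s \<omega> \<in> A \<and> X t \<omega> - X s \<omega> \<in> B} \<omega> \<partial>M)"
    by (rule nn_integral_cong) (simp split: split_indicator)
  then have "emeasure M {\<omega>\<in>space M. X s \<omega> \<in> A \<and> X t \<omega> - X s \<omega> \<in> B}
     = emeasure M {\<omega>\<in>space M. X s \<omega> \<in> A} * emeasure M {\<omega>\<in>space M. X (t - s) \<omega> \<in> B}"
    using indep_increments_nn_integral [OF X st, of "indicator A" "indicator B"] by (simp add: em)
  then show ?thesis by (simp add: measure_def enn2real_mult)
qed

section \<open>Laws and path properties of the Poisson process\<close>

lemma poisson_process_measurable:
  assumes "poisson_process M l N" "t \<ge> 0"
  shows "N t \<in> M \<rightarrow>\<^sub>M count_space UNIV"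
proof -
  have [measurable]: "(\<lambda>\<omega>. real (N t \<omega>)) \<in> borel_measurable M"
    using assms by (simp add: poisson_process_def subordinator_def)
  have "N t = (\<lambda>\<omega>. nat \<lfloor>real (N t \<omega>)\<rfloor>)" by auto
  also have "\<dots> \<in> M \<rightarrow>\<^sub>M count_space UNIV" by measurable
  finally show ?thesis .
qed

lemma prob_poisson_process:
  assumes N: "poisson_process M l N" and "l > 0" "t \<ge> 0"
  shows "\<P>(\<omega> in M. N t \<omega> = k) = poisson_weight (l * t) k"
proof (cases "t = 0")
  \<comment> \<open>The Poisson law is prescribed for positive times only; at time 0 the path starts
    at 0 almost surely, which agrees with the weights of mean 0.\<close>
  case True
  have [measurable]: "N 0 \<in> M \<rightarrow>\<^sub>M count_space UNIV"
    using poisson_process_measurable [OF N] by simp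
  have "AE \<omega> in M. N 0 \<omega> = 0"
    using N by (simp add: poisson_process_def subordinator_def)
  then have ae: "AE \<omega> in M. N 0 \<omega> = k \<longleftrightarrow> k = 0" by eventually_elim auto
  have "\<P>(\<omega> in M. N 0 \<omega> = k) = \<P>(\<omega> in M. k = 0)"
    by (intro measure_eq_AE) (use ae in \<open>auto elim!: eventually_mono\<close>)
  with True show ?thesis by (simp add: prob_space)
next
  case False
  then have t: "t > 0" using assms by simp
  note [measurable] = poisson_process_measurable [OF N \<open>t \<ge> 0\<close>]
  have "distr M (count_space UNIV) (N t) = measure_pmf (poisson_pmf (l * t))"
    using N t by (simp add: poisson_process_def)
  then have "measure (distr M (count_space UNIV) (N t)) {k} = pmf (poisson_pmf (l * t)) k"
    by (simp add: pmf.rep_eq)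
  moreover have "measure (distr M (count_space UNIV) (N t)) {k} = \<P>(\<omega> in M. N t \<omega> = k)"
    by (subst measure_distr) (auto intro!: arg_cong [where f = "measure M"])
  ultimately show ?thesis
    using t \<open>l > 0\<close> by (simp add: poisson_weight_def)
qed

text \<open>Leaving \<open>k\<close> by time \<open>t\<close> means a nonzero increment; it is
  independent of the value at \<open>s\<close>, and it is zero with probability
  \<open>exp (- (l * (t - s)))\<close>.\<close>

lemma prob_poisson_process_increment:
  assumes N: "poisson_process M l N" and "l > 0" and st: "0 \<le> s" "s \<le> t"
  shows "\<P>(\<omega> in M. N s \<omega> = k \<and> N t \<omega> \<noteq> k)
       = poisson_weight (l * s) k * (1 - exp (- (l * (t - s))))"
proof -
  let ?X = "\<lambda>t \<omega>. real (N t \<omega>)"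
  have X: "subordinator M ?X" using N by (simp add: poisson_process_def)
  have ts: "t - s \<ge> 0" using st by simp
  have [measurable]: "N (t - s) \<in> M \<rightarrow>\<^sub>M count_space UNIV"
    by (rule poisson_process_measurable [OF N ts])
  have "\<P>(\<omega> in M. ?X s \<omega> \<in> {real k} \<and> ?X t \<omega> - ?X s \<omega> \<in> - {0})
      = \<P>(\<omega> in M. ?X s \<omega> \<in> {real k}) * \<P>(\<omega> in M. ?X (t - s) \<omega> \<in> - {0})"
    by (rule prob_indep_increments [OF X st]) auto
  also have "\<P>(\<omega> in M. ?X (t - s) \<omega> \<in> - {0}) = 1 - \<P>(\<omega> in M. N (t - s) \<omega> = 0)"
    by (subst prob_neg [symmetric]) (auto intro!: arg_cong [where f = prob])
  finally have *: "\<P>(\<omega> in M. ?X s \<omega> \<in> {real k} \<and> ?X t \<omega> - ?X s \<omega> \<in> - {0})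
      = poisson_weight (l * s) k * (1 - poisson_weight (l * (t - s)) 0)"
    by (simp add: prob_poisson_process [OF N \<open>l > 0\<close>] st)
  have "\<P>(\<omega> in M. N s \<omega> = k \<and> N t \<omega> \<noteq> k)
      = \<P>(\<omega> in M. ?X s \<omega> \<in> {real k} \<and> ?X t \<omega> - ?X s \<omega> \<in> - {0})"
    by (rule arg_cong [where f = prob]) auto
  with * show ?thesis by (simp add: poisson_weight_def)
qed

text \<open>The bound is of second order in the length of the interval, so it still tends to 0 when
  summed over the intervals of a finer and finer grid. The difference is taken in the reals, so that
  downward moves count as bad too.\<close>

lemma prob_poisson_process_jump_le:
  assumes N: "poisson_process M l N" and "l > 0" and st: "0 \<le> s" "s \<le> t"
  shows "\<P>(\<omega> in M. real (N t \<omega>) - real (N s \<omega>) \<notin> {0, 1}) \<le> (l * (t - s))\<^sup>2"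
proof -
  let ?X = "\<lambda>t \<omega>. real (N t \<omega>)"
  have X: "subordinator M ?X" using N by (simp add: poisson_process_def)
  have ts: "t - s \<ge> 0" using st by simp
  define x where "x = l * (t - s)"
  have "x \<ge> 0" using \<open>l > 0\<close> ts by (simp add: x_def)
  note [measurable] = poisson_process_measurable [OF N ts]
  have "\<P>(\<omega> in M. real (N t \<omega>) - real (N s \<omega>) \<notin> {0, 1})
      = \<P>(\<omega> in M. ?X s \<omega> \<in> UNIV \<and> ?X t \<omega> - ?X s \<omega> \<in> - {0, 1})"
    by (rule arg_cong [where f = prob]) auto
  also have "\<dots> = \<P>(\<omega> in M. ?X s \<omega> \<in> UNIV) * \<P>(\<omega> in M. ?X (t - s) \<omega> \<in> - {0, 1})"
    by (rule prob_indep_increments [OF X st]) auto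
  also have "\<P>(\<omega> in M. ?X (t - s) \<omega> \<in> - {0, 1})
      = 1 - \<P>(\<omega> in M. N (t - s) \<omega> = 0 \<or> N (t - s) \<omega> = 1)"
    by (subst prob_neg [symmetric]) (auto intro!: arg_cong [where f = prob])
  also have "\<P>(\<omega> in M. N (t - s) \<omega> = 0 \<or> N (t - s) \<omega> = 1)
      = \<P>(\<omega> in M. N (t - s) \<omega> = 0) + \<P>(\<omega> in M. N (t - s) \<omega> = 1)"
    by (subst finite_measure_Union [symmetric]) (auto intro!: arg_cong [where f = prob])
  finally have "\<P>(\<omega> in M. real (N t \<omega>) - real (N s \<omega>) \<notin> {0, 1}) = 1 - (1 + x) * exp (- x)"
    using prob_poisson_process [OF N \<open>l > 0\<close> ts]
    by (simp add: prob_space poisson_weight_def x_def algebra_simps)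
  \<comment> \<open>Uses that \<open>exp (- x)\<close> is at least \<open>1 - x\<close>.\<close>
  also have "\<dots> \<le> 1 - (1 + x) * (1 - x)"
    using exp_ge_add_one_self [of "- x"] \<open>x \<ge> 0\<close> by (auto intro!: mult_left_mono)
  also have "\<dots> = x\<^sup>2" by (simp add: power2_eq_square algebra_simps)
  finally show ?thesis by (simp add: x_def)
qed

text \<open>Staying at or below \<open>k\<close> along the whole sequence forces it at each single
  \<open>s n\<close>, which has probability at most a finite sum of Poisson weights with means
  tending to infinity.\<close>

lemma poisson_process_AE_unbounded:
  assumes N: "poisson_process M l N" and "l > 0"
    and s: "\<And>n. s n \<ge> 0" "filterlim s at_top sequentially"
  shows "AE \<omega> in M. \<forall>k. \<exists>n::nat. N (s n) \<omega> > k"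
  unfolding AE_all_countable
proof
  fix k
  have [measurable]: "N (s n) \<in> M \<rightarrow>\<^sub>M count_space UNIV" for n
    using poisson_process_measurable [OF N] s by simp
  have "\<P>(\<omega> in M. \<forall>n. N (s n) \<omega> \<le> k) \<le> (\<Sum>j\<le>k. poisson_weight (l * s n) j)" for n
  proof -
    have "\<P>(\<omega> in M. \<forall>n. N (s n) \<omega> \<le> k) \<le> prob (\<Union>j\<le>k. {\<omega>\<in>space M. N (s n) \<omega> = j})"
      by (intro finite_measure_mono) auto
    also have "\<dots> \<le> (\<Sum>j\<le>k. \<P>(\<omega> in M. N (s n) \<omega> = j))"
      by (intro finite_measure_subadditive_finite) auto
    finally show ?thesis using prob_poisson_process [OF N \<open>l > 0\<close> s(1)] by simp
  qed
  moreover have "(\<lambda>n. \<Sum>j\<le>k. poisson_weight (l * s n) j) \<longlonglongrightarrow> (\<Sum>j\<le>k. 0)"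
    using \<open>l > 0\<close> s
    by (intro tendsto_sum poisson_weight_tendsto_zero
        filterlim_tendsto_pos_mult_at_top [OF tendsto_const]) auto
  ultimately have "\<P>(\<omega> in M. \<forall>n. N (s n) \<omega> \<le> k) \<le> 0"
    by (intro LIMSEQ_le_const) auto
  then have "\<P>(\<omega> in M. \<forall>n. N (s n) \<omega> \<le> k) = 0"
    using measure_nonneg [of M] by (simp add: order_antisym)
  then have "AE \<omega> in M. \<not> (\<forall>n. N (s n) \<omega> \<le> k)"
    by (subst (asm) prob_eq_0) auto
  then show "AE \<omega> in M. \<exists>n. N (s n) \<omega> > k"
    by eventually_elim (auto simp: not_le)
qed

text \<open>On a grid of mesh \<open>1/m\<close>, skipping a level requires a jump of at least two between
  neighbouring grid points, which has probability \<open>O(1/m)\<close>.\<close>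

lemma poisson_process_AE_hits:
  assumes N: "poisson_process M l N" and "l > 0"
  shows "AE \<omega> in M. \<forall>n. \<exists>i j::nat. N (real i / real (Suc j)) \<omega> = n"
proof -
  let ?t = "\<lambda>m i. real i / real (Suc m)"
  note meas = poisson_process_measurable [OF N]
  have N0: "AE \<omega> in M. N 0 \<omega> = 0"
    using N by (simp add: poisson_process_def subordinator_def)
  have unb: "AE \<omega> in M. \<forall>k. \<exists>n::nat. N (real n) \<omega> > k"
    by (rule poisson_process_AE_unbounded [OF N \<open>l > 0\<close>]) (auto intro: filterlim_real_sequentially)
  have no_skip: "AE \<omega> in M. \<exists>m. \<forall>i < Suc m * T. N (?t m (Suc i)) \<omega> = N (?t m i) \<omega> \<or>
      N (?t m (Suc i)) \<omega> = Suc (N (?t m i) \<omega>)" for T :: nat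
  proof -
    let ?A = "\<lambda>m i. {\<omega>\<in>space M. real (N (?t m (Suc i)) \<omega>) - real (N (?t m i) \<omega>) \<notin> {0, 1}}"
    have A [measurable]: "?A m i \<in> sets M" for m i
    proof -
      have [measurable]: "N (?t m i) \<in> M \<rightarrow>\<^sub>M count_space UNIV"
          "N (?t m (Suc i)) \<in> M \<rightarrow>\<^sub>M count_space UNIV"
        by (rule meas, simp)+
      show ?thesis by measurable
    qed
    \<comment> \<open>An outcome that is bad on every grid is bad on the grid with index
      \<open>m\<close>, whose \<open>Suc m * T\<close> intervals contribute at most
      \<open>(l / real (Suc m))\<^sup>2\<close> each.\<close>
    have bound: "prob (\<Inter>m. \<Union>i<Suc m * T. ?A m i) \<le> real T * l\<^sup>2 * (1 / real (Suc m))" for m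
    proof -
      have "prob (\<Inter>m. \<Union>i<Suc m * T. ?A m i) \<le> prob (\<Union>i<Suc m * T. ?A m i)"
        by (rule finite_measure_mono) (use A in auto)
      also have "\<dots> \<le> (\<Sum>i<Suc m * T. prob (?A m i))"
        by (rule finite_measure_subadditive_finite) (use A in blast)+
      also have "\<dots> \<le> (\<Sum>i<Suc m * T. (l * (1 / real (Suc m)))\<^sup>2)"
      proof (rule sum_mono)
        fix i
        have "?t m (Suc i) - ?t m i = 1 / real (Suc m)" by (simp add: divide_simps)
        then show "prob (?A m i) \<le> (l * (1 / real (Suc m)))\<^sup>2"
          using prob_poisson_process_jump_le [OF N \<open>l > 0\<close>, of "?t m i" "?t m (Suc i)"]
          by (simp add: divide_right_mono)
      qed
      also have "\<dots> = (real (Suc m) * real T) * (l * (1 / real (Suc m)))\<^sup>2"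
        by (simp only: sum_constant card_lessThan of_nat_mult)
      also have "\<dots> = real T * l\<^sup>2 * (1 / real (Suc m))"
        by (simp add: power2_eq_square del: of_nat_Suc)
      finally show ?thesis .
    qed
    moreover have "(\<lambda>m. real T * l\<^sup>2 * (1 / real (Suc m))) \<longlonglongrightarrow> real T * l\<^sup>2 * 0"
      by (intro tendsto_mult tendsto_const LIMSEQ_Suc [OF lim_1_over_n])
    ultimately have "prob (\<Inter>m. \<Union>i<Suc m * T. ?A m i) \<le> 0"
      by (intro LIMSEQ_le_const) auto
    then have "prob (\<Inter>m. \<Union>i<Suc m * T. ?A m i) = 0"
      using measure_nonneg [of M] by (simp add: order_antisym)
    then have "(\<Inter>m. \<Union>i<Suc m * T. ?A m i) \<in> null_sets M"
      using A by (auto simp: emeasure_eq_measure null_sets_def)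
    from AE_not_in [OF this] AE_space show ?thesis
    proof eventually_elim
      case (elim \<omega>)
      then obtain m where m: "\<forall>i<Suc m * T.
          real (N (?t m (Suc i)) \<omega>) - real (N (?t m i) \<omega>) \<in> {0, 1}"
        by (auto simp del: of_nat_Suc mult_Suc)
      have "N (?t m (Suc i)) \<omega> = N (?t m i) \<omega> \<or> N (?t m (Suc i)) \<omega> = Suc (N (?t m i) \<omega>)"
        if "i < Suc m * T" for i
      proof -
        have "real (N (?t m (Suc i)) \<omega>) = real (N (?t m i) \<omega>) \<or>
            real (N (?t m (Suc i)) \<omega>) = real (Suc (N (?t m i) \<omega>))"
          using m [rule_format, OF that] by auto
        then show ?thesis unfolding of_nat_eq_iff .
      qed
      then show ?case by blast
    qed
  qed
  then have "AE \<omega> in M. \<forall>T. \<exists>m. \<forall>i < Suc m * T. N (?t m (Suc i)) \<omega> = N (?t m i) \<omega> \<or>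
      N (?t m (Suc i)) \<omega> = Suc (N (?t m i) \<omega>)"
    by (simp add: AE_all_countable)
  with unb N0 show ?thesis
  proof eventually_elim
    case (elim \<omega>)
    show ?case
    proof
      fix n
      obtain T :: nat where T: "N (real T) \<omega> > n" using elim(1) by blast
      obtain m where m: "\<forall>i < Suc m * T. N (?t m (Suc i)) \<omega> = N (?t m i) \<omega> \<or>
          N (?t m (Suc i)) \<omega> = Suc (N (?t m i) \<omega>)" using elim(3) by blast
      \<comment> \<open>The horizon \<open>T\<close> is a natural number, hence a point of every
        grid.\<close>
      have "?t m (Suc m * T) = real T"
        by (subst of_nat_mult) (simp del: of_nat_Suc)
      with T have "N (?t m (Suc m * T)) \<omega> > n" by simp
      \<comment> \<open>Discrete intermediate value argument: starting from 0 with steps 0 or 1, the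
        grid values cannot pass \<open>n\<close> without taking it.\<close>
      moreover have "i \<le> Suc m * T \<Longrightarrow> (\<exists>i'\<le>i. N (?t m i') \<omega> = n) \<or> N (?t m i) \<omega> < n" for i
      proof (induction i)
        case 0
        then show ?case using elim(2) by auto
      next
        case (Suc i)
        then have "i < Suc m * T" by simp
        with m have "N (?t m (Suc i)) \<omega> = N (?t m i) \<omega> \<or> N (?t m (Suc i)) \<omega> = Suc (N (?t m i) \<omega>)"
          by blast
        then show ?case using Suc by (auto simp del: of_nat_Suc intro: le_SucI) 
      qed
      ultimately show "\<exists>i j::nat. N (real i / real (Suc j)) \<omega> = n"
        by (metis order_refl less_asym)
    qed
  qed
qed

section \<open>Monotone paths, and hitting a level along a deterministic sequence\<close>

lemma subordinator_AE_nonneg_mono: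
  assumes "subordinator M X"
  shows "AE \<omega> in M. X 0 \<omega> = 0 \<and> (\<forall>s\<ge>0. \<forall>t\<ge>s. X s \<omega> \<le> X t \<omega>)"
proof -
  have "AE \<omega> in M. X 0 \<omega> = 0" "AE \<omega> in M. mono_on {0..} (\<lambda>t. X t \<omega>)"
    using assms by (simp_all add: subordinator_def)
  then show ?thesis by eventually_elim (auto simp: mono_on_def)
qed

lemma subordinator_AE_nonneg:
  assumes "subordinator M X"
  shows "AE \<omega> in M. \<forall>t\<ge>0. X t \<omega> \<ge> 0"
  using subordinator_AE_nonneg_mono [OF assms] by eventually_elim force

text \<open>Splits according to the last term of the sequence at which the level \<open>k\<close> is attained.\<close>

lemma emeasure_poisson_process_hits_sequence:
  assumes N: "poisson_process M l N" and "l > 0"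
    and s: "\<And>n. s n \<ge> 0" "\<And>n. s n \<le> s (Suc n)" "filterlim s at_top sequentially"
  shows "emeasure M {\<omega>\<in>space M. \<exists>n. N (s n) \<omega> = k}
       = (\<Sum>n. ennreal (poisson_weight (l * s n) k * (1 - exp (- (l * (s (Suc n) - s n))))))"
proof -
  have [measurable]: "N (s n) \<in> M \<rightarrow>\<^sub>M count_space UNIV" for n
    by (rule poisson_process_measurable [OF N s(1)])
  have "subordinator M (\<lambda>t \<omega>. real (N t \<omega>))" using N by (simp add: poisson_process_def)
  from subordinator_AE_nonneg_mono [OF this]
  have mono: "AE \<omega> in M. \<forall>m n. m \<le> n \<longrightarrow> N (s m) \<omega> \<le> N (s n) \<omega>"
  proof eventually_elim
    case (elim \<omega>)
    have "s m \<le> s n" if "m \<le> n" for m n using lift_Suc_mono_le [of s, OF s(2) that] .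
    then have "real (N (s m) \<omega>) \<le> real (N (s n) \<omega>)" if "m \<le> n" for m n
      using elim s(1) that by blast
    then show ?case by simp
  qed
  define A where "A n = {\<omega>\<in>space M. N (s n) \<omega> = k \<and> (\<forall>m>n. N (s m) \<omega> \<noteq> k)}" for n
  have meas [measurable]: "A n \<in> sets M" for n
    unfolding A_def by measurable
  have disj: "disjoint_family A"
    unfolding disjoint_family_on_def
  proof (intro ballI impI)
    fix m n :: nat
    assume "m \<noteq> n"
    then consider "m < n" | "n < m" by (meson nat_neq_iff)
    then show "A m \<inter> A n = {}" by cases (auto simp: A_def)
  qed
  have AE: "AE \<omega> in M. \<omega> \<in> {\<omega>\<in>space M. \<exists>n. N (s n) \<omega> = k} \<longleftrightarrow> \<omega> \<in> (\<Union>n. A n)"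
    using poisson_process_AE_unbounded [OF N \<open>l > 0\<close> s(1) s(3)] mono
  proof eventually_elim
    case (elim \<omega>)
    have "\<omega> \<in> (\<Union>n. A n)" if "\<omega> \<in> space M" and hit: "N (s n) \<omega> = k" for n
    proof -
      \<comment> \<open>By monotonicity all terms from \<open>b\<close> on exceed \<open>k\<close>,
        so the set of hits is finite and has a last element.\<close>
      let ?H = "{n. N (s n) \<omega> = k}"
      obtain b where b: "N (s b) \<omega> > k" using elim(1) by blast
      have "?H \<subseteq> {..b}"
      proof
        fix n assume "n \<in> ?H"
        then show "n \<in> {..b}" using b elim(2) [rule_format, of b n] by (cases "n \<le> b") auto
      qed
      then have fin: "finite ?H" by (rule finite_subset) simp
      define m where "m = Max ?H"
      have "m \<in> ?H" unfolding m_def using hit by (intro Max_in fin) auto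
      moreover have "N (s i) \<omega> \<noteq> k" if "i > m" for i
        using Max_ge [OF fin, of i] that by (auto simp: m_def [symmetric])
      ultimately have "\<omega> \<in> A m" using \<open>\<omega> \<in> space M\<close> by (simp add: A_def)
      then show ?thesis by blast
    qed
    moreover have "\<exists>n. N (s n) \<omega> = k" "\<omega> \<in> space M" if "\<omega> \<in> (\<Union>n. A n)"
      using that by (auto simp: A_def)
    ultimately show ?case by blast
  qed
  have "emeasure M {\<omega>\<in>space M. \<exists>n. N (s n) \<omega> = k} = emeasure M (\<Union>n. A n)"
    by (rule emeasure_eq_AE [OF AE]) measurable
  also have "\<dots> = (\<Sum>n. emeasure M (A n))"
    by (rule suminf_emeasure [symmetric]) (use meas disj in auto)
  also have "\<dots> = (\<Sum>n. ennreal (poisson_weight (l * s n) k * (1 - exp (- (l * (s (Suc n) - s n))))))"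
  proof (rule suminf_cong)
    fix n
    \<comment> \<open>A nondecreasing sequence that has left \<open>k\<close> never returns, so
      being the last visit depends on two consecutive terms only.\<close>
    have "AE \<omega> in M. \<omega> \<in> A n \<longleftrightarrow> \<omega> \<in> {\<omega>\<in>space M. N (s n) \<omega> = k \<and> N (s (Suc n)) \<omega> \<noteq> k}"
      using mono
    proof eventually_elim
      case (elim \<omega>)
      have "N (s m) \<omega> \<noteq> k" if "N (s n) \<omega> = k" "N (s (Suc n)) \<omega> \<noteq> k" "m > n" for m
        using elim [rule_format, of n "Suc n"] elim [rule_format, of "Suc n" m] that by auto
      then show ?case by (auto simp: A_def)
    qed
    then have "emeasure M (A n) = emeasure M {\<omega>\<in>space M. N (s n) \<omega> = k \<and> N (s (Suc n)) \<omega> \<noteq> k}"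
      by (rule emeasure_eq_AE) measurable
    then show "emeasure M (A n)
        = ennreal (poisson_weight (l * s n) k * (1 - exp (- (l * (s (Suc n) - s n)))))"
      by (simp only: emeasure_eq_measure prob_poisson_process_increment [OF N \<open>l > 0\<close> s(1,2)])
  qed
  finally show ?thesis .
qed

section \<open>The exponential process at integer times\<close>

lemma exponential_process_integral:
  assumes E: "exponential_process M \<beta> E" and "\<beta> > 0" "t \<ge> 0" "u \<ge> 0"
  shows "integrable M (\<lambda>\<omega>. exp (- (u * E t \<omega>)))"
    and "(\<integral>\<omega>. exp (- (u * E t \<omega>)) \<partial>M) = (1 + u / \<beta>) powr (- t)"
proof -
  show I: "(\<integral>\<omega>. exp (- (u * E t \<omega>)) \<partial>M) = (1 + u / \<beta>) powr (- t)"
    using assms by (simp add: exponential_process_def)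
  \<comment> \<open>A non-integrable function has integral 0 by convention, so the positive value of
    the Laplace transform yields integrability.\<close>
  have "1 + u / \<beta> > 0" using assms by (simp add: add_pos_nonneg)
  then have "(\<integral>\<omega>. exp (- (u * E t \<omega>)) \<partial>M) \<noteq> 0" unfolding I by simp
  then show "integrable M (\<lambda>\<omega>. exp (- (u * E t \<omega>)))"
    using not_integrable_integral_eq by blast
qed

text \<open>The Laplace transforms at \<open>u = 1\<close> form a convergent geometric series, so
  the sum of \<open>exp (- E (real (Suc n)))\<close> has finite expectation. It is then almost
  surely finite, its terms tend to 0, and \<open>E\<close> tends to infinity along the
  integers.\<close>

lemma exponential_process_AE_tendsto:
  assumes E: "exponential_process M \<beta> E" and "\<beta> > 0"
  shows "AE \<omega> in M. filterlim (\<lambda>n. E (real n) \<omega>) at_top sequentially"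
proof -
  have sub: "subordinator M E" using E by (simp add: exponential_process_def)
  have [measurable]: "E (real n) \<in> borel_measurable M" for n
    using sub by (simp add: subordinator_def)
  have q: "1 / \<beta> > 0" using \<open>\<beta> > 0\<close> by simp
  have "(\<integral>\<^sup>+\<omega>. (\<Sum>n. ennreal (exp (- E (real (Suc n)) \<omega>))) \<partial>M)
      = (\<Sum>n. \<integral>\<^sup>+\<omega>. ennreal (exp (- E (real (Suc n)) \<omega>)) \<partial>M)"
    by (rule nn_integral_suminf) measurable
  also have "\<dots> = (\<Sum>n. ennreal ((1 + 1 / \<beta>) powr (- real (Suc n))))"
  proof (rule suminf_cong)
    fix n
    show "(\<integral>\<^sup>+\<omega>. ennreal (exp (- E (real (Suc n)) \<omega>)) \<partial>M)
        = ennreal ((1 + 1 / \<beta>) powr (- real (Suc n)))"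
      using exponential_process_integral [OF E \<open>\<beta> > 0\<close>, of "real (Suc n)" 1]
      by (subst nn_integral_eq_integral) auto
  qed
  also have "\<dots> = ennreal (1 / (1 / \<beta>))"
    by (rule suminf_ennreal_eq [OF _ sums_geometric_inverse [OF q]]) simp
  finally have "(\<integral>\<^sup>+\<omega>. (\<Sum>n. ennreal (exp (- E (real (Suc n)) \<omega>))) \<partial>M) \<noteq> \<infinity>"
    by simp
  with _ have "AE \<omega> in M. (\<Sum>n. ennreal (exp (- E (real (Suc n)) \<omega>))) \<noteq> \<infinity>"
    by (rule nn_integral_PInf_AE) measurable
  then show ?thesis
  proof eventually_elim
    case (elim \<omega>)
    then have "summable (\<lambda>n. exp (- E (real (Suc n)) \<omega>))"
      by (intro summable_suminf_not_top) auto
    then have "(\<lambda>n. exp (- E (real (Suc n)) \<omega>)) \<longlonglongrightarrow> 0"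
      by (rule summable_LIMSEQ_zero)
    then have "(\<lambda>n. exp (- E (real n) \<omega>)) \<longlonglongrightarrow> 0"
      by (rule LIMSEQ_imp_Suc)
    then have "filterlim (\<lambda>n. exp (- E (real n) \<omega>)) (at_right 0) sequentially"
      by (auto simp: filterlim_at)
    then have "filterlim (\<lambda>n. - ln (exp (- E (real n) \<omega>))) at_top sequentially"
      by (intro filterlim_compose [OF filterlim_uminus_at_top_at_bot]
          filterlim_compose [OF ln_at_0])
    then show ?case by simp
  qed
qed

text \<open>For \<open>u = (1 - z) l\<close> the Laplace transforms of the \<open>E (n + 1)\<close> add up to a geometric
  series with sum \<open>\<beta> / u\<close>, so the generating function in \<open>k\<close> is \<open>(\<beta> / l) / (1 - z)\<close>.\<close>

lemma suminf_poisson_weight_exponential_process: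
  assumes E: "exponential_process M \<beta> E" and "\<beta> > 0" "l > 0"
  shows "(\<Sum>n. \<integral>\<^sup>+\<omega>. ennreal (poisson_weight (l * E (real (Suc n)) \<omega>) k) \<partial>M) = ennreal (\<beta> / l)"
proof -
  have sub: "subordinator M E" using E by (simp add: exponential_process_def)
  have [measurable]: "E (real n) \<in> borel_measurable M" "E (real (Suc n)) \<in> borel_measurable M" for n
    using sub by (simp_all add: subordinator_def)
  \<comment> \<open>Indices start at \<open>Suc n\<close>: the term at time 0 would add 1 for
    \<open>k = 0\<close> only, and without it the sum over \<open>n\<close> is the same for every
    \<open>k\<close>.\<close>
  define w where "w n k = (\<integral>\<^sup>+\<omega>. ennreal (poisson_weight (l * E (real (Suc n)) \<omega>) k) \<partial>M)" for n k
  define a where "a k = (\<Sum>n. w n k)" for k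
  have gf: "(\<Sum>k. a k * ennreal (z ^ k)) = ennreal (\<beta> / l / (1 - z))" if z: "0 < z" "z < 1" for z
  proof -
    define q where "q = (1 - z) * l / \<beta>"
    have q: "q > 0" using z assms by (simp add: q_def)
    have "(\<Sum>k. a k * ennreal (z ^ k)) = (\<Sum>n. \<Sum>k. w n k * ennreal (z ^ k))"
      unfolding a_def ennreal_suminf_multc [symmetric] by (rule suminf_swap_ennreal)
    also have "\<dots> = (\<Sum>n. ennreal ((1 + q) powr (- real (Suc n))))"
    proof (rule suminf_cong)
      fix n
      have "(\<Sum>k. w n k * ennreal (z ^ k)) = (\<Sum>k. \<integral>\<^sup>+\<omega>. ennreal (poisson_weight (l * E (real (Suc n)) \<omega>) k)
          * ennreal (z ^ k) \<partial>M)"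
        unfolding w_def by (intro suminf_cong nn_integral_multc [symmetric]) measurable
      also have "\<dots> = (\<integral>\<^sup>+\<omega>. (\<Sum>k. ennreal (poisson_weight (l * E (real (Suc n)) \<omega>) k)
          * ennreal (z ^ k)) \<partial>M)"
        by (rule nn_integral_suminf [symmetric]) measurable
      also have "\<dots> = (\<integral>\<^sup>+\<omega>. ennreal (exp (- ((1 - z) * l * E (real (Suc n)) \<omega>))) \<partial>M)"
      proof (rule nn_integral_cong_AE, use subordinator_AE_nonneg [OF sub] in eventually_elim)
        case (elim \<omega>)
        then have x: "l * E (real (Suc n)) \<omega> \<ge> 0" using \<open>l > 0\<close> by simp
        have "(\<Sum>k. ennreal (poisson_weight (l * E (real (Suc n)) \<omega>) k * z ^ k))
            = ennreal (exp (- ((1 - z) * (l * E (real (Suc n)) \<omega>))))"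
          by (rule suminf_ennreal_eq [OF _ poisson_weight_gf_sums])
             (use poisson_weight_nonneg [OF x] z in auto)
        then show ?case
          using z by (simp add: ennreal_mult'' mult.assoc)
      qed
      also have "\<dots> = ennreal ((1 + q) powr (- real (Suc n)))"
        using exponential_process_integral [OF E \<open>\<beta> > 0\<close>, of "real (Suc n)" "(1 - z) * l"] z \<open>l > 0\<close>
        by (subst nn_integral_eq_integral) (auto simp: q_def)
      finally show "(\<Sum>k. w n k * ennreal (z ^ k)) = ennreal ((1 + q) powr (- real (Suc n)))" .
    qed
    also have "\<dots> = ennreal (1 / q)"
      by (rule suminf_ennreal_eq [OF _ sums_geometric_inverse [OF q]]) simp
    also have "1 / q = \<beta> / l / (1 - z)" by (simp add: q_def)
    finally show ?thesis .
  qed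
  \<comment> \<open>The generating function is finite at 1/2, hence so is each coefficient. This
    permits the passage to real power series, where coefficients can be compared.\<close>
  have "a k \<noteq> top" for k
  proof
    assume "a k = top"
    then have "a k * ennreal ((1 / 2) ^ k) = top"
      by (simp add: ennreal_top_mult)
    moreover have "a k * ennreal ((1 / 2) ^ k) < top"
      by (rule ennreal_suminf_lessD) (use gf [of "1 / 2"] in auto)
    ultimately show False by simp
  qed
  then have a: "a k = ennreal (enn2real (a k))" for k by (simp add: less_top)
  have "(\<lambda>k. enn2real (a k) * z ^ k) sums (\<beta> / l / (1 - z))" if z: "0 < z" "z < 1" for z
  proof -
    have "(\<lambda>k. a k * ennreal (z ^ k)) sums ennreal (\<beta> / l / (1 - z))"
      using gf [OF z] by (simp add: sums_iff)
    moreover have "a k * ennreal (z ^ k) = ennreal (enn2real (a k) * z ^ k)" for k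
      by (subst a) (use z in \<open>simp add: ennreal_mult''\<close>)
    ultimately have "(\<lambda>k. ennreal (enn2real (a k) * z ^ k)) sums ennreal (\<beta> / l / (1 - z))" by simp
    then show ?thesis by (subst (asm) sums_ennreal) (use z assms in auto)
  qed
  from geometric_coefficients_unique [OF this] have "enn2real (a k) = \<beta> / l" .
  with a [of k] show ?thesis unfolding a_def w_def by simp
qed

lemma nn_integral_exponential_process_hits:
  assumes E: "exponential_process M \<beta> E" and "\<beta> > 0" "l > 0" "k \<ge> 1"
  shows "(\<integral>\<^sup>+\<omega>. (\<Sum>n. ennreal (poisson_weight (l * E (real n) \<omega>) k *
            (1 - exp (- (l * (E (real (Suc n)) \<omega> - E (real n) \<omega>)))))) \<partial>M) = ennreal (\<beta> / (l + \<beta>))"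
proof -
  have sub: "subordinator M E" using E by (simp add: exponential_process_def)
  have [measurable]: "E (real n) \<in> borel_measurable M" "E (real (Suc n)) \<in> borel_measurable M"
      "E 1 \<in> borel_measurable M" for n
    using sub by (simp_all add: subordinator_def)
  define w where "w n = (\<integral>\<^sup>+\<omega>. ennreal (poisson_weight (l * E (real n) \<omega>) k) \<partial>M)" for n
  \<comment> \<open>Here \<open>k \<ge> 1\<close> enters: the walk starts at 0, where the Poisson
    weight of \<open>k\<close> vanishes. The sum over all \<open>n\<close> thus equals the sum over
    \<open>Suc n\<close> computed before.\<close>
  have w0: "w 0 = 0"
  proof -
    have "w 0 = (\<integral>\<^sup>+\<omega>. 0 \<partial>M)"
      unfolding w_def
      by (rule nn_integral_cong_AE, use subordinator_AE_nonneg_mono [OF sub] in eventually_elim)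
         (use \<open>k \<ge> 1\<close> in auto)
    then show ?thesis by simp
  qed
  \<comment> \<open>One minus the Laplace transform of \<open>E 1\<close> at \<open>l\<close>, which
    is \<open>\<beta> / (l + \<beta>)\<close>.\<close>
  have step: "(\<integral>\<^sup>+\<omega>. ennreal (1 - exp (- (l * E 1 \<omega>))) \<partial>M) = ennreal (l / (l + \<beta>))"
  proof -
    note I = exponential_process_integral [OF E \<open>\<beta> > 0\<close>, of 1 l]
    have "(\<integral>\<^sup>+\<omega>. ennreal (1 - exp (- (l * E 1 \<omega>))) \<partial>M)
        = ennreal (\<integral>\<omega>. 1 - exp (- (l * E 1 \<omega>)) \<partial>M)"
    proof (rule nn_integral_eq_integral)
      show "AE \<omega> in M. 0 \<le> 1 - exp (- (l * E 1 \<omega>))"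
        using subordinator_AE_nonneg [OF sub] by eventually_elim (use \<open>l > 0\<close> in simp)
    qed (use I \<open>l > 0\<close> in simp)
    also have "(\<integral>\<omega>. 1 - exp (- (l * E 1 \<omega>)) \<partial>M) = 1 - (1 + l / \<beta>) powr (- 1)"
      using I \<open>l > 0\<close> by (simp add: prob_space)
    also have "\<dots> = l / (l + \<beta>)"
    proof -
      have "1 + l / \<beta> > 0" using assms by (simp add: add_pos_pos)
      then have "(1 + l / \<beta>) powr (- 1) = 1 / (1 + l / \<beta>)" by (simp add: powr_minus_divide)
      also have "\<dots> = \<beta> / (l + \<beta>)" using assms by (simp add: field_simps)
      finally show ?thesis using assms by (simp add: field_simps)
    qed
    finally show ?thesis .
  qed
  have "(\<integral>\<^sup>+\<omega>. (\<Sum>n. ennreal (poisson_weight (l * E (real n) \<omega>) k *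
            (1 - exp (- (l * (E (real (Suc n)) \<omega> - E (real n) \<omega>)))))) \<partial>M)
      = (\<Sum>n. \<integral>\<^sup>+\<omega>. ennreal (poisson_weight (l * E (real n) \<omega>) k *
            (1 - exp (- (l * (E (real (Suc n)) \<omega> - E (real n) \<omega>))))) \<partial>M)"
    by (rule nn_integral_suminf) measurable
  also have "\<dots> = (\<Sum>n. w n * ennreal (l / (l + \<beta>)))"
  proof (rule suminf_cong)
    fix n
    let ?f = "\<lambda>x. ennreal (poisson_weight (l * x) k)" and ?g = "\<lambda>x. ennreal (1 - exp (- (l * x)))"
    have "(\<integral>\<^sup>+\<omega>. ennreal (poisson_weight (l * E (real n) \<omega>) k *
            (1 - exp (- (l * (E (real (Suc n)) \<omega> - E (real n) \<omega>))))) \<partial>M)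
        = (\<integral>\<^sup>+\<omega>. ?f (E (real n) \<omega>) * ?g (E (real (Suc n)) \<omega> - E (real n) \<omega>) \<partial>M)"
    proof (rule nn_integral_cong_AE, use subordinator_AE_nonneg [OF sub] in eventually_elim)
      case (elim \<omega>)
      then have "l * E (real n) \<omega> \<ge> 0" using \<open>l > 0\<close> by simp
      then show ?case by (intro ennreal_mult' poisson_weight_nonneg)
    qed
    also have "\<dots> = (\<integral>\<^sup>+\<omega>. ?f (E (real n) \<omega>) \<partial>M) * (\<integral>\<^sup>+\<omega>. ?g (E (real (Suc n) - real n) \<omega>) \<partial>M)"
      by (rule indep_increments_nn_integral [OF sub]) (simp_all, measurable)
    finally show "(\<integral>\<^sup>+\<omega>. ennreal (poisson_weight (l * E (real n) \<omega>) k *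
            (1 - exp (- (l * (E (real (Suc n)) \<omega> - E (real n) \<omega>))))) \<partial>M)
        = w n * ennreal (l / (l + \<beta>))"
      by (simp add: step w_def)
  qed
  also have "\<dots> = (\<Sum>n. w n) * ennreal (l / (l + \<beta>))"
    by simp
  also have "(\<Sum>n. w n) = ennreal (\<beta> / l)"
  proof -
    have "(\<lambda>n. w (Suc n)) sums ennreal (\<beta> / l)"
      using suminf_poisson_weight_exponential_process [OF E \<open>\<beta> > 0\<close> \<open>l > 0\<close>, of k]
      unfolding w_def by (simp add: sums_iff)
    from sums_unique [OF sums_Suc [OF this]] w0 show ?thesis by simp
  qed
  also have "ennreal (\<beta> / l) * ennreal (l / (l + \<beta>)) = ennreal (\<beta> / l * (l / (l + \<beta>)))"
    using assms by (intro ennreal_mult [symmetric]) auto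
  also have "\<beta> / l * (l / (l + \<beta>)) = \<beta> / (l + \<beta>)" using assms by simp
  finally show ?thesis .
qed

end

section \<open>The hitting event and its probability\<close>

text \<open>The hitting event agrees with a measurable event only up to a null set. Outside a
  measurable null set \<open>Z\<close> the two sets coincide, and \<open>A \<inter> Z\<close> is
  measurable in the completion as a subset of \<open>Z\<close>.\<close>

lemma measure_completion_eq_AE:
  assumes AE: "AE x in M. x \<in> A \<longleftrightarrow> x \<in> B" and "B \<in> sets M" "A \<subseteq> space M"
  shows "measure (completion M) A = measure M B"
proof -
  have AE': "AE x in completion M. x \<in> A \<longleftrightarrow> x \<in> B" by (rule AE_completion [OF AE])
  obtain Z where Z: "{x\<in>space M. \<not> (x \<in> A \<longleftrightarrow> x \<in> B)} \<subseteq> Z" "Z \<in> null_sets M"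
    using AE by (auto simp: eventually_ae_filter)
  have "A = (B - Z) \<union> (A \<inter> Z)"
    using Z(1) assms sets.sets_into_space [OF \<open>B \<in> sets M\<close>] by blast
  then have "A \<in> sets (completion M)"
    by (rule sets_completionI [where N' = Z]) (use Z assms in auto)
  then have "measure (completion M) A = measure (completion M) B"
    by (intro measure_eq_AE AE') (use assms in auto)
  then show ?thesis using assms by simp
qed

text \<open>The candidate times are all finite, so their infimum is below infinity as soon as there
  is one, attained or not.\<close>

lemma hitting_time_less_infinity_iff: "hitting_time Z k \<omega> < \<infinity> \<longleftrightarrow> (\<exists>s\<ge>0. Z s \<omega> = k)"
  unfolding hitting_time_def Inf_less_iff by auto

theorem theorem4:
  fixes M :: "'a measure"
    and N\<^sub>1 N :: "real \<Rightarrow> 'a \<Rightarrow> nat"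
    and E E\<^sub>N :: "real \<Rightarrow> 'a \<Rightarrow> real"
    and l\<^sub>1 l \<beta> :: real
    and k :: nat
  assumes "prob_space M"
    and "l\<^sub>1 > 0" "l > 0" "\<beta> > 0"
    and "poisson_process M l\<^sub>1 N\<^sub>1"
    and "poisson_process M l N"
    and "exponential_process M \<beta> E"
    and "indep_processes M E (\<lambda>t \<omega>. real (N t \<omega>))"
    and "E\<^sub>N = time_changed E (\<lambda>t \<omega>. real (N t \<omega>))"
    and "indep_processes M (\<lambda>t \<omega>. real (N\<^sub>1 t \<omega>)) E\<^sub>N"
    and "k \<ge> 1"
  shows "measure (completion M)
           {\<omega> \<in> space M. hitting_time (time_changed N\<^sub>1 E\<^sub>N) k \<omega> < \<infinity>} = \<beta> / (l\<^sub>1 + \<beta>)"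
proof -
  interpret prob_space M by fact
  interpret MM: pair_prob_space M M ..
  note N1 = \<open>poisson_process M l\<^sub>1 N\<^sub>1\<close> and N = \<open>poisson_process M l N\<close>
    and E = \<open>exponential_process M \<beta> E\<close>
  have subN1: "subordinator M (\<lambda>t \<omega>. real (N\<^sub>1 t \<omega>))" using N1 by (simp add: poisson_process_def)
  have subE: "subordinator M E" using E by (simp add: exponential_process_def)
  have EN: "E\<^sub>N t \<omega> = E (real (N t \<omega>)) \<omega>" for t \<omega>
    using assms by (simp add: time_changed_def)

  let ?P = "\<Pi>\<^sub>M t\<in>{0::real..}. (borel :: real measure)"
  define X where "X \<omega> = (\<lambda>t\<in>{0..}. real (N\<^sub>1 t \<omega>))" for \<omega>
  define Y where "Y \<omega> = (\<lambda>t\<in>{0..}. E\<^sub>N t \<omega>)" for \<omega>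
  have indep: "indep_var ?P X ?P Y"
    using \<open>indep_processes M (\<lambda>t \<omega>. real (N\<^sub>1 t \<omega>)) E\<^sub>N\<close>
    unfolding indep_processes_def X_def Y_def .
  then have [measurable]: "X \<in> M \<rightarrow>\<^sub>M ?P" "Y \<in> M \<rightarrow>\<^sub>M ?P"
    by (blast dest: indep_var_rv1 indep_var_rv2)+

  \<comment> \<open>Countably many times suffice: \<open>N\<close> almost surely takes each natural
    value at some time of the form \<open>real i / real (Suc j)\<close>, so \<open>E\<^sub>N\<close>
    takes every value \<open>E n\<close> at such a time.\<close>
  define R where "R p \<longleftrightarrow> (\<exists>i j. grid_value (fst p) (snd p (real i / real (Suc j))) k)"
    for p :: "(real \<Rightarrow> real) \<times> (real \<Rightarrow> real)"
  have R [measurable]: "Measurable.pred (?P \<Otimes>\<^sub>M ?P) R"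
    unfolding R_def
  proof (intro pred_intros_countable measurable_grid_value)
    show "(\<lambda>p. fst p t) \<in> borel_measurable (?P \<Otimes>\<^sub>M ?P)" if "t \<ge> 0" for t
      using that by (intro measurable_compose [OF measurable_fst measurable_component_singleton]) simp
    show "(\<lambda>p. snd p (real i / real (Suc j))) \<in> borel_measurable (?P \<Otimes>\<^sub>M ?P)" for i j
      by (intro measurable_compose [OF measurable_snd measurable_component_singleton]) simp
  qed

  text \<open>For regular paths, \<open>R\<close> decides whether \<open>N\<^sub>1\<close> takes the value \<open>k\<close> along \<open>E (n)\<close>; the two
    processes may be sampled at different outcomes.\<close>
  define good\<^sub>1 where "good\<^sub>1 \<omega> \<longleftrightarrow> (\<forall>t\<ge>0. continuous (at_right t) (\<lambda>s. real (N\<^sub>1 s \<omega>)))" for \<omega>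
  define good\<^sub>2 where "good\<^sub>2 \<omega> \<longleftrightarrow> (\<forall>t\<ge>0. E t \<omega> \<ge> 0) \<and>
    (\<forall>n. \<exists>i j. N (real i / real (Suc j)) \<omega> = n)" for \<omega>
  have good\<^sub>1: "AE \<omega> in M. good\<^sub>1 \<omega>"
    using subN1 unfolding good\<^sub>1_def by (simp add: subordinator_def)
  have good\<^sub>2: "AE \<omega> in M. good\<^sub>2 \<omega>"
    using subordinator_AE_nonneg [OF subE] poisson_process_AE_hits [OF N \<open>l > 0\<close>]
    by eventually_elim (simp add: good\<^sub>2_def)
  have R_iff: "R (X \<omega>\<^sub>1, Y \<omega>\<^sub>2) \<longleftrightarrow> (\<exists>n. N\<^sub>1 (E (real n) \<omega>\<^sub>2) \<omega>\<^sub>1 = k)"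
    if "good\<^sub>1 \<omega>\<^sub>1" "good\<^sub>2 \<omega>\<^sub>2" for \<omega>\<^sub>1 \<omega>\<^sub>2
  proof -
    have "grid_value (X \<omega>\<^sub>1) y k \<longleftrightarrow> N\<^sub>1 y \<omega>\<^sub>1 = k" if "y \<ge> 0" for y
    proof -
      have "grid_value (X \<omega>\<^sub>1) y k \<longleftrightarrow> grid_value (\<lambda>s. real (N\<^sub>1 s \<omega>\<^sub>1)) y k"
        by (simp add: grid_value_def X_def)
      also have "\<dots> \<longleftrightarrow> N\<^sub>1 y \<omega>\<^sub>1 = k"
        by (rule grid_value_iff) (use that \<open>good\<^sub>1 \<omega>\<^sub>1\<close> in \<open>simp_all add: good\<^sub>1_def\<close>)
      finally show ?thesis .
    qed
    moreover have "Y \<omega>\<^sub>2 (real i / real (Suc j)) = E (real (N (real i / real (Suc j)) \<omega>\<^sub>2)) \<omega>\<^sub>2" for i j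
      by (simp add: Y_def EN)
    ultimately have "R (X \<omega>\<^sub>1, Y \<omega>\<^sub>2) \<longleftrightarrow>
        (\<exists>i j. N\<^sub>1 (E (real (N (real i / real (Suc j)) \<omega>\<^sub>2)) \<omega>\<^sub>2) \<omega>\<^sub>1 = k)"
      using \<open>good\<^sub>2 \<omega>\<^sub>2\<close> by (simp add: R_def good\<^sub>2_def del: of_nat_Suc)
    also have "\<dots> \<longleftrightarrow> (\<exists>n. N\<^sub>1 (E (real n) \<omega>\<^sub>2) \<omega>\<^sub>1 = k)"
      using \<open>good\<^sub>2 \<omega>\<^sub>2\<close> unfolding good\<^sub>2_def by metis
    finally show ?thesis .
  qed

  \<comment> \<open>The hitting event is a union over uncountably many times; almost surely it
    coincides with an event that is measurable in the pair of paths.\<close>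
  have hit_iff: "AE \<omega> in M. \<omega> \<in> {\<omega> \<in> space M. hitting_time (time_changed N\<^sub>1 E\<^sub>N) k \<omega> < \<infinity>}
      \<longleftrightarrow> \<omega> \<in> {\<omega> \<in> space M. R (X \<omega>, Y \<omega>)}"
    using good\<^sub>1 good\<^sub>2
  proof eventually_elim
    case (elim \<omega>)
    have "hitting_time (time_changed N\<^sub>1 E\<^sub>N) k \<omega> < \<infinity>
        \<longleftrightarrow> (\<exists>s\<ge>0. N\<^sub>1 (E (real (N s \<omega>)) \<omega>) \<omega> = k)"
      by (simp only: hitting_time_less_infinity_iff time_changed_def EN)
    also have "\<dots> \<longleftrightarrow> (\<exists>n. N\<^sub>1 (E (real n) \<omega>) \<omega> = k)"
    proof
      assume "\<exists>n. N\<^sub>1 (E (real n) \<omega>) \<omega> = k"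
      then obtain n where n: "N\<^sub>1 (E (real n) \<omega>) \<omega> = k" ..
      obtain i j where "N (real i / real (Suc j)) \<omega> = n"
        using elim(2) unfolding good\<^sub>2_def by blast
      with n show "\<exists>s\<ge>0. N\<^sub>1 (E (real (N s \<omega>)) \<omega>) \<omega> = k"
        by (intro exI [of _ "real i / real (Suc j)"]) simp
    qed blast
    also have "\<dots> \<longleftrightarrow> R (X \<omega>, Y \<omega>)"
      using R_iff [OF elim] by simp
    finally show ?case by (simp only: mem_Collect_eq)
  qed

  have "emeasure M {\<omega> \<in> space M. R (X \<omega>, Y \<omega>)}
      = emeasure (distr M (?P \<Otimes>\<^sub>M ?P) (\<lambda>\<omega>. (X \<omega>, Y \<omega>))) {p \<in> space (?P \<Otimes>\<^sub>M ?P). R p}"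
    by (subst emeasure_distr) (auto intro!: arg_cong [where f = "emeasure M"]
        dest: measurable_space [OF \<open>X \<in> M \<rightarrow>\<^sub>M ?P\<close>] measurable_space [OF \<open>Y \<in> M \<rightarrow>\<^sub>M ?P\<close>]
        simp: space_pair_measure)
  \<comment> \<open>Independence makes the joint law of the two paths a product, which is also the
    law obtained by drawing two outcomes independently.\<close>
  also have "distr M (?P \<Otimes>\<^sub>M ?P) (\<lambda>\<omega>. (X \<omega>, Y \<omega>)) = distr M ?P X \<Otimes>\<^sub>M distr M ?P Y"
    using indep by (simp add: indep_var_distribution_eq)
  also have "\<dots> = distr (M \<Otimes>\<^sub>M M) (?P \<Otimes>\<^sub>M ?P) (\<lambda>(x, y). (X x, Y y))"
    by (intro pair_measure_distr prob_space_imp_sigma_finite prob_space_distr) measurable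
  also have "emeasure \<dots> {p \<in> space (?P \<Otimes>\<^sub>M ?P). R p}
      = emeasure (M \<Otimes>\<^sub>M M) {q \<in> space (M \<Otimes>\<^sub>M M). R (X (fst q), Y (snd q))}"
    by (subst emeasure_distr) (auto intro!: arg_cong [where f = "emeasure (M \<Otimes>\<^sub>M M)"]
        dest: measurable_space [OF \<open>X \<in> M \<rightarrow>\<^sub>M ?P\<close>] measurable_space [OF \<open>Y \<in> M \<rightarrow>\<^sub>M ?P\<close>]
        simp: space_pair_measure)
  \<comment> \<open>With \<open>\<omega>\<^sub>2\<close> fixed the values \<open>E n\<close> form a
    deterministic sequence, nondecreasing and tending to infinity, and only \<open>N\<^sub>1\<close>
    remains random.\<close>
  also have "\<dots> = (\<integral>\<^sup>+\<omega>\<^sub>2. emeasure M ((\<lambda>\<omega>\<^sub>1. (\<omega>\<^sub>1, \<omega>\<^sub>2)) -`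
      {q \<in> space (M \<Otimes>\<^sub>M M). R (X (fst q), Y (snd q))}) \<partial>M)"
    by (rule MM.emeasure_pair_measure_alt2) measurable
  also have "\<dots> = (\<integral>\<^sup>+\<omega>\<^sub>2. (\<Sum>n. ennreal (poisson_weight (l\<^sub>1 * E (real n) \<omega>\<^sub>2) k *
      (1 - exp (- (l\<^sub>1 * (E (real (Suc n)) \<omega>\<^sub>2 - E (real n) \<omega>\<^sub>2)))))) \<partial>M)"
  proof (rule nn_integral_cong_AE, use AE_space good\<^sub>2 subordinator_AE_nonneg_mono [OF subE]
      exponential_process_AE_tendsto [OF E \<open>\<beta> > 0\<close>] in eventually_elim)
    case (elim \<omega>\<^sub>2)
    have pos: "E (real n) \<omega>\<^sub>2 \<ge> 0" and incr: "E (real n) \<omega>\<^sub>2 \<le> E (real (Suc n)) \<omega>\<^sub>2" for n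
      using elim(2,3) by (simp_all add: good\<^sub>2_def)
    have [measurable]: "N\<^sub>1 (E (real n) \<omega>\<^sub>2) \<in> M \<rightarrow>\<^sub>M count_space UNIV" for n
      by (rule poisson_process_measurable [OF N1 pos])
    have "emeasure M ((\<lambda>\<omega>\<^sub>1. (\<omega>\<^sub>1, \<omega>\<^sub>2)) -` {q \<in> space (M \<Otimes>\<^sub>M M). R (X (fst q), Y (snd q))})
        = emeasure M {\<omega>\<^sub>1 \<in> space M. R (X \<omega>\<^sub>1, Y \<omega>\<^sub>2)}"
      using elim(1) by (intro arg_cong [where f = "emeasure M"]) (auto simp: space_pair_measure)
    also have "\<dots> = emeasure M {\<omega>\<^sub>1 \<in> space M. \<exists>n. N\<^sub>1 (E (real n) \<omega>\<^sub>2) \<omega>\<^sub>1 = k}"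
    proof (rule emeasure_eq_AE)
      show "AE \<omega>\<^sub>1 in M. \<omega>\<^sub>1 \<in> {\<omega>\<^sub>1 \<in> space M. R (X \<omega>\<^sub>1, Y \<omega>\<^sub>2)}
          \<longleftrightarrow> \<omega>\<^sub>1 \<in> {\<omega>\<^sub>1 \<in> space M. \<exists>n. N\<^sub>1 (E (real n) \<omega>\<^sub>2) \<omega>\<^sub>1 = k}"
        using good\<^sub>1 by eventually_elim (simp add: R_iff elim(2))
      have "Y \<omega>\<^sub>2 \<in> space ?P"
        using measurable_space [OF \<open>Y \<in> M \<rightarrow>\<^sub>M ?P\<close> elim(1)] .
      then show "{\<omega>\<^sub>1 \<in> space M. R (X \<omega>\<^sub>1, Y \<omega>\<^sub>2)} \<in> sets M" by measurable
    qed measurable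
    also have "\<dots> = (\<Sum>n. ennreal (poisson_weight (l\<^sub>1 * E (real n) \<omega>\<^sub>2) k *
      (1 - exp (- (l\<^sub>1 * (E (real (Suc n)) \<omega>\<^sub>2 - E (real n) \<omega>\<^sub>2))))))"
      by (rule emeasure_poisson_process_hits_sequence [OF N1 \<open>l\<^sub>1 > 0\<close> pos incr elim(4)])
    finally show ?case .
  qed
  also have "\<dots> = ennreal (\<beta> / (l\<^sub>1 + \<beta>))"
    by (rule nn_integral_exponential_process_hits [OF E \<open>\<beta> > 0\<close> \<open>l\<^sub>1 > 0\<close> \<open>k \<ge> 1\<close>])
  finally have "measure M {\<omega> \<in> space M. R (X \<omega>, Y \<omega>)} = \<beta> / (l\<^sub>1 + \<beta>)"
    using assms by (simp add: measure_def)
  with measure_completion_eq_AE [OF hit_iff] show ?thesis by simp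
qed

end
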